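(* Let $G_0=\mathbb{I}\oplus\mathbb{I}\ell$ and $\pi=\sqrt5=2\varphi-1$. For $v\in G_0\setminus\pi G_0$ consider the one-generator gluing $G_v=G_0+\mathbb{Z}[\varphi]\frac{v}{\pi}$, which depends only on the projective line spanned by the class of $v$ in $G_0/\pi G_0\simeq\mathbb{F}_5^8$. No projective line satisfies the polar-pairing condition: there is no $v\in G_0\setminus\pi G_0$ with $B(v/\pi,g)\in\mathbb{Z}[\varphi]$ for all $g\in G_0$. Hence for no nonzero $\mathbb{F}_5$-subspace $C\subset G_0/\pi G_0$ is $$G_0+\pi^{-1}C:=\{\,v/\pi : v\in G_0,\ v\bmod \pi G_0\in C\,\}$$ a strict norm-integral overmodule of $G_0$, i.e. it is not the case that $N(x)\in\mathbb{Z}[\varphi]$ for all $x\in G_0+\pi^{-1}C$.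
   Context: Let $\varphi=(1+\sqrt5)/2$, $K=\mathbb{Q}(\sqrt5)$. $\mathbb{H}(K)$ is the quaternion algebra over $K$ with basis $1,i,j,k$, $i^2=j^2=k^2=ijk=-1$, standard conjugation. The icosian ring $\mathbb{I}\subset\mathbb{H}(K)$ is the free $\mathbb{Z}[\varphi]$-module with basis $$e_1=1,\quad e_2=i,\quad e_3=\tfrac12(1+i+j+k),\quad e_4=\tfrac12(-1+(\varphi-1)i-\varphi j).$$ $\mathbb{O}(K)=\mathbb{H}(K)\oplus\mathbb{H}(K)\ell$ is the Cayley--Dickson double with product $(a+b\ell)(c+d\ell)=(ac-\overline{d}b)+(da+b\overline{c})\ell$, conjugation $\overline{a+b\ell}=\overline{a}-b\ell$, and norm $N(x)=x\overline{x}$. The polar form is $B(x,y)=N(x+y)-N(x)-N(y)$. Here $\mathbb{Z}[\varphi]/(\sqrt5)\cong\mathbb{F}_5$. *)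

theory Defs
  imports Complex_Main "HOL-Algebra.QuotRing" "HOL-Algebra.Module" "HOL-Number_Theory.Residues"
begin

section \<open>The field \<open>K = \<rat>(\<surd>5)\<close> and its subring \<open>\<int>[\<phi>]\<close>\<close>

typedef K = "{x::real. \<exists>a\<in>\<rat>. \<exists>b\<in>\<rat>. x = a + b * sqrt 5}"
  by (rule exI[of _ 0]) (auto intro!: bexI[of _ 0])

setup_lifting type_definition_K

lemma sqrt5_norm_neq_0:
  assumes "a \<in> \<rat>" "b \<in> \<rat>" "a \<noteq> 0 \<or> b \<noteq> 0"
  shows "a\<^sup>2 - 5 * b\<^sup>2 \<noteq> (0::real)"
proof
  assume eq: "a\<^sup>2 - 5 * b\<^sup>2 = 0"
  with assms(3) have b: "b \<noteq> 0" by auto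
  with eq have "(a / b)\<^sup>2 = 5" by (simp add: field_simps)
  then have "sqrt 5 = \<bar>a / b\<bar>" by (metis real_sqrt_abs)
  moreover have "\<bar>a / b\<bar> \<in> \<rat>" using assms by auto
  moreover have "sqrt (real 5) \<notin> \<rat>"
  proof
    assume "sqrt (real 5) \<in> \<rat>"
    then obtain m n :: nat where n: "n \<noteq> 0" and sq: "\<bar>sqrt (real 5)\<bar> = real m / real n"
      and cop: "coprime m n" by (rule Rats_abs_nat_div_natE)
    from n sq have "real m = sqrt 5 * real n" by (simp add: field_simps)
    then have "real (m\<^sup>2) = real (5 * n\<^sup>2)" by (simp add: power_mult_distrib)
    then have mn: "m\<^sup>2 = 5 * n\<^sup>2" by (simp only: of_nat_eq_iff)
    have p: "prime (5::nat)" by simp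
    from mn have "5 dvd m\<^sup>2" by simp
    then have dm: "5 dvd m" using p prime_dvd_power by blast
    then obtain k where "m = 5 * k" ..
    with mn have "n\<^sup>2 = 5 * k\<^sup>2" by (simp add: power2_eq_square)
    then have "5 dvd n\<^sup>2" by simp
    then have "5 dvd n" using p prime_dvd_power by blast
    with dm cop show False by (metis coprime_common_divisor_nat numeral_eq_one_iff semiring_norm(86))
  qed
  ultimately show False by simp
qed

instantiation K :: field
begin

lift_definition zero_K :: K is 0 by (auto intro!: bexI[of _ 0])
lift_definition one_K :: K is 1 by (rule bexI[of _ 1], rule bexI[of _ 0]) auto

lift_definition plus_K :: "K \<Rightarrow> K \<Rightarrow> K" is "(+)"
proof -
  fix x y :: real
  assume "\<exists>a\<in>\<rat>. \<exists>b\<in>\<rat>. x = a + b * sqrt 5" "\<exists>a\<in>\<rat>. \<exists>b\<in>\<rat>. y = a + b * sqrt 5"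
  then obtain a b c d where "a \<in> \<rat>" "b \<in> \<rat>" "c \<in> \<rat>" "d \<in> \<rat>"
    "x = a + b * sqrt 5" "y = c + d * sqrt 5" by blast
  then show "\<exists>a\<in>\<rat>. \<exists>b\<in>\<rat>. x + y = a + b * sqrt 5"
    by (intro bexI[of _ "a + c"] bexI[of _ "b + d"]) (auto simp: algebra_simps)
qed

lift_definition uminus_K :: "K \<Rightarrow> K" is uminus
proof -
  fix x :: real
  assume "\<exists>a\<in>\<rat>. \<exists>b\<in>\<rat>. x = a + b * sqrt 5"
  then obtain a b where "a \<in> \<rat>" "b \<in> \<rat>" "x = a + b * sqrt 5" by blast
  then show "\<exists>a\<in>\<rat>. \<exists>b\<in>\<rat>. - x = a + b * sqrt 5"
    by (intro bexI[of _ "- a"] bexI[of _ "- b"]) (auto simp: algebra_simps)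
qed

lift_definition minus_K :: "K \<Rightarrow> K \<Rightarrow> K" is "(-)"
proof -
  fix x y :: real
  assume "\<exists>a\<in>\<rat>. \<exists>b\<in>\<rat>. x = a + b * sqrt 5" "\<exists>a\<in>\<rat>. \<exists>b\<in>\<rat>. y = a + b * sqrt 5"
  then obtain a b c d where "a \<in> \<rat>" "b \<in> \<rat>" "c \<in> \<rat>" "d \<in> \<rat>"
    "x = a + b * sqrt 5" "y = c + d * sqrt 5" by blast
  then show "\<exists>a\<in>\<rat>. \<exists>b\<in>\<rat>. x - y = a + b * sqrt 5"
    by (intro bexI[of _ "a - c"] bexI[of _ "b - d"]) (auto simp: algebra_simps)
qed

lift_definition times_K :: "K \<Rightarrow> K \<Rightarrow> K" is "(*)"
proof -
  fix x y :: real
  assume "\<exists>a\<in>\<rat>. \<exists>b\<in>\<rat>. x = a + b * sqrt 5" "\<exists>a\<in>\<rat>. \<exists>b\<in>\<rat>. y = a + b * sqrt 5"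
  then obtain a b c d where "a \<in> \<rat>" "b \<in> \<rat>" "c \<in> \<rat>" "d \<in> \<rat>"
    "x = a + b * sqrt 5" "y = c + d * sqrt 5" by blast
  then show "\<exists>a\<in>\<rat>. \<exists>b\<in>\<rat>. x * y = a + b * sqrt 5"
    by (intro bexI[of _ "a * c + 5 * (b * d)"] bexI[of _ "a * d + b * c"]) (auto simp: algebra_simps)
qed

lift_definition inverse_K :: "K \<Rightarrow> K" is inverse
proof -
  fix x :: real
  assume "\<exists>a\<in>\<rat>. \<exists>b\<in>\<rat>. x = a + b * sqrt 5"
  then obtain a b where ab: "a \<in> \<rat>" "b \<in> \<rat>" "x = a + b * sqrt 5" by blast
  show "\<exists>a\<in>\<rat>. \<exists>b\<in>\<rat>. inverse x = a + b * sqrt 5"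
  proof (cases "x = 0")
    case True
    then show ?thesis by (auto intro!: bexI[of _ 0])
  next
    case False
    define n where "n = a\<^sup>2 - 5 * b\<^sup>2"
    from False ab have "a \<noteq> 0 \<or> b \<noteq> 0" by auto
    then have n: "n \<noteq> 0" "n \<in> \<rat>"
      using ab sqrt5_norm_neq_0 unfolding n_def by (blast, simp)
    have "x * (a - b * sqrt 5) = n"
      by (simp add: ab n_def algebra_simps power2_eq_square)
    then have "x * ((a - b * sqrt 5) / n) = 1" using n(1) by simp
    then have "inverse x = (a - b * sqrt 5) / n" using inverse_unique by blast
    then have "inverse x = a / n + (- b / n) * sqrt 5" by (simp add: diff_divide_distrib)
    moreover have "a / n \<in> \<rat>" "- b / n \<in> \<rat>" using ab n by auto
    ultimately show ?thesis by blast
  qed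
qed

definition divide_K :: "K \<Rightarrow> K \<Rightarrow> K" where "divide_K x y = x * inverse y"

instance
  by standard (transfer; simp add: algebra_simps divide_K_def)+

end

lemma Rep_K_of_nat: "Rep_K (of_nat n) = of_nat n"
  by (induction n) (simp_all add: zero_K.rep_eq one_K.rep_eq plus_K.rep_eq)

instance K :: field_char_0
  by standard (metis Rep_K_of_nat injI of_nat_eq_iff)

lift_definition phi :: K ("\<phi>") is "(1 + sqrt 5) / 2"
  by (rule bexI[of _ "1/2"], rule bexI[of _ "1/2"]) (auto simp: field_simps)

lift_definition sqrt5 :: K is "sqrt 5"
  by (rule bexI[of _ 0], rule bexI[of _ 1]) auto

definition Zphi :: "K set" where
  "Zphi = {of_int a + of_int b * \<phi> | a b. True}"

definition Zphi_ring :: "K ring" where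
  "Zphi_ring = \<lparr>carrier = Zphi, monoid.mult = (*), one = 1, zero = 0, add = (+)\<rparr>"


section \<open>Quaternions\<close>

datatype 'a quat = Quat (qre: 'a) (qi: 'a) (qj: 'a) (qk: 'a)

lemmas quat_eqI = quat.expand[simplified]

instantiation quat :: (comm_ring_1) ring_1
begin

definition "0 = Quat 0 0 0 0"
definition "1 = Quat 1 0 0 0"
definition "x + y = Quat (qre x + qre y) (qi x + qi y) (qj x + qj y) (qk x + qk y)"
definition "- x = Quat (- qre x) (- qi x) (- qj x) (- qk x)"
definition "x - y = Quat (qre x - qre y) (qi x - qi y) (qj x - qj y) (qk x - qk y)"
definition "x * y = Quat
  (qre x * qre y - qi x * qi y - qj x * qj y - qk x * qk y)
  (qre x * qi y + qi x * qre y + qj x * qk y - qk x * qj y)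
  (qre x * qj y - qi x * qk y + qj x * qre y + qk x * qi y)
  (qre x * qk y + qi x * qj y - qj x * qi y + qk x * qre y)"

instance
  by standard
    (auto simp: zero_quat_def one_quat_def plus_quat_def uminus_quat_def minus_quat_def
      times_quat_def algebra_simps)

end

lemma quat_relations:
  fixes i j k :: "'a::comm_ring_1 quat"
  defines "i \<equiv> Quat 0 1 0 0" and "j \<equiv> Quat 0 0 1 0" and "k \<equiv> Quat 0 0 0 1"
  shows "i * i = -1" "j * j = -1" "k * k = -1" "i * j * k = -1"
  by (simp_all add: i_def j_def k_def times_quat_def uminus_quat_def one_quat_def)

definition qconj :: "'a::comm_ring_1 quat \<Rightarrow> 'a quat" where
  "qconj x = Quat (qre x) (- qi x) (- qj x) (- qk x)"

definition qscale :: "'a::comm_ring_1 \<Rightarrow> 'a quat \<Rightarrow> 'a quat" where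
  "qscale c x = Quat (c * qre x) (c * qi x) (c * qj x) (c * qk x)"


section \<open>The Cayley--Dickson double\<close>

text \<open>\<open>Oct a b\<close> stands for \<open>a + b\<ell>\<close>.\<close>

datatype 'a octo = Oct (oct1: "'a quat") (oct2: "'a quat")

instantiation octo :: (comm_ring_1) "{ab_group_add, one, times}"
begin

definition "0 = Oct 0 0"
definition "1 = Oct 1 0"
definition "x + y = Oct (oct1 x + oct1 y) (oct2 x + oct2 y)"
definition "- x = Oct (- oct1 x) (- oct2 x)"
definition "x - y = Oct (oct1 x - oct1 y) (oct2 x - oct2 y)"
definition "x * y = Oct (oct1 x * oct1 y - qconj (oct2 y) * oct2 x) (oct2 y * oct1 x + oct2 x * qconj (oct1 y))"

instance
  by standard
    (auto simp: zero_octo_def plus_octo_def uminus_octo_def minus_octo_def algebra_simps)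

end

definition oconj :: "'a::comm_ring_1 octo \<Rightarrow> 'a octo" where
  "oconj x = Oct (qconj (oct1 x)) (- oct2 x)"

definition oscale :: "'a::comm_ring_1 \<Rightarrow> 'a octo \<Rightarrow> 'a octo" where
  "oscale c x = Oct (qscale c (oct1 x)) (qscale c (oct2 x))"

text \<open>The product \<open>x * oconj x\<close> is a scalar multiple of 1 (lemma \<open>mult_oconj\<close>); \<open>oct_norm x\<close> is
  that scalar, read off as the coefficient of 1.\<close>

definition oct_norm :: "'a::comm_ring_1 octo \<Rightarrow> 'a" where
  "oct_norm x = qre (oct1 (x * oconj x))"

lemma mult_oconj: "x * oconj x = oscale (oct_norm x) 1"
  by (cases x; cases "oct1 x"; cases "oct2 x")
    (auto simp: oct_norm_def oscale_def qscale_def oconj_def qconj_def times_octo_def times_quat_def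
      one_octo_def one_quat_def zero_quat_def minus_quat_def plus_quat_def uminus_quat_def
      algebra_simps)

definition polar :: "'a::comm_ring_1 octo \<Rightarrow> 'a octo \<Rightarrow> 'a" where
  "polar x y = oct_norm (x + y) - oct_norm x - oct_norm y"


section \<open>The icosian lattice \<open>G\<^sub>0\<close> and its reduction modulo \<open>\<surd>5\<close>\<close>

definition e1 :: "K quat" where "e1 = Quat 1 0 0 0"
definition e2 :: "K quat" where "e2 = Quat 0 1 0 0"
definition e3 :: "K quat" where "e3 = qscale (1/2) (Quat 1 1 1 1)"
definition e4 :: "K quat" where "e4 = qscale (1/2) (Quat (-1) (\<phi> - 1) (- \<phi>) 0)"

definition icosians :: "K quat set" where
  "icosians = {qscale a e1 + qscale b e2 + qscale c e3 + qscale d e4 | a b c d.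
     a \<in> Zphi \<and> b \<in> Zphi \<and> c \<in> Zphi \<and> d \<in> Zphi}"

lemma phi_neq_0: "\<phi> \<noteq> 0"
  by transfer (simp add: add_pos_nonneg less_imp_neq[symmetric])

lemma icosian_basis_independent:
  assumes "qscale a e1 + qscale b e2 + qscale c e3 + qscale d e4 = 0"
  shows "a = 0 \<and> b = 0 \<and> c = 0 \<and> d = 0"
  using assms phi_neq_0
  by (auto simp: e1_def e2_def e3_def e4_def qscale_def plus_quat_def zero_quat_def)

definition G0 :: "K octo set" where
  "G0 = {Oct a b | a b. a \<in> icosians \<and> b \<in> icosians}"

definition piG0 :: "K octo set" where
  "piG0 = oscale sqrt5 ` G0"

text \<open>A subset of \<open>\<bbbO>(K)\<close> with the ambient operations; the \<open>mult\<close> and \<open>one\<close> fields are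
  present only because HOL-Algebra module records extend ring records.\<close>

definition oct_module :: "K octo set \<Rightarrow> (K, K octo) module" where
  "oct_module M = \<lparr>carrier = M, monoid.mult = (*), one = 1, zero = 0, add = (+), smult = oscale\<rparr>"

text \<open>The quotient \<open>M / H\<close> by a submodule \<open>H\<close>, as a module over \<open>R / I\<close>, for an ideal \<open>I\<close> of the
  scalar ring \<open>R\<close> with \<open>I M \<subseteq> H\<close>. The additive structure is that of \<^const>\<open>FactRing\<close>
  and scalar multiplication follows the pattern of \<^const>\<open>rcoset_mult\<close>:
  \<open>(I + a)(H + x) = H + ax\<close>.\<close>

definition quot_module :: "('a, 'b, 'c) module_scheme \<Rightarrow> 'b set \<Rightarrow> ('a set, 'b set) module" where
  "quot_module M H = \<lparr>carrier = a_rcosets\<^bsub>M\<^esub> H, monoid.mult = rcoset_mult M H,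
     one = H +>\<^bsub>M\<^esub> \<one>\<^bsub>M\<^esub>, zero = H, add = set_add M,
     smult = (\<lambda>A X. \<Union>a\<in>A. \<Union>x\<in>X. H +>\<^bsub>M\<^esub> (a \<odot>\<^bsub>M\<^esub> x))\<rparr>"

definition residue_field :: "K set ring" where
  "residue_field = Zphi_ring Quot (PIdl\<^bsub>Zphi_ring\<^esub> sqrt5)"

definition G0_mod_pi :: "(K set, K octo set) module" where
  "G0_mod_pi = quot_module (oct_module G0) piG0"

definition class_mod_pi :: "K octo \<Rightarrow> K octo set" where
  "class_mod_pi v = piG0 +>\<^bsub>oct_module G0\<^esub> v"

definition proj_line :: "K octo \<Rightarrow> K octo set set" where
  "proj_line v = {A \<odot>\<^bsub>G0_mod_pi\<^esub> class_mod_pi v | A. A \<in> carrier residue_field}"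


section \<open>Coordinate modules and isomorphisms over isomorphic rings\<close>

definition coord_module :: "('a, 'b) ring_scheme \<Rightarrow> nat \<Rightarrow> ('a, nat \<Rightarrow> 'a) module" where
  "coord_module R n = \<lparr>carrier = {..<n} \<rightarrow>\<^sub>E carrier R,
     monoid.mult = (\<lambda>x y. \<lambda>i\<in>{..<n}. x i \<otimes>\<^bsub>R\<^esub> y i),
     one = (\<lambda>i\<in>{..<n}. \<one>\<^bsub>R\<^esub>),
     zero = (\<lambda>i\<in>{..<n}. \<zero>\<^bsub>R\<^esub>), add = (\<lambda>x y. \<lambda>i\<in>{..<n}. x i \<oplus>\<^bsub>R\<^esub> y i),
     smult = (\<lambda>a x. \<lambda>i\<in>{..<n}. a \<otimes>\<^bsub>R\<^esub> x i)\<rparr>"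

definition semilinear_iso ::
  "('a \<Rightarrow> 'c) \<Rightarrow> ('a, 'e) ring_scheme \<Rightarrow> ('a, 'b, 'f) module_scheme \<Rightarrow> ('c, 'd, 'g) module_scheme
    \<Rightarrow> ('b \<Rightarrow> 'd) set" where
  "semilinear_iso \<sigma> R M N = {f. bij_betw f (carrier M) (carrier N) \<and>
     (\<forall>x\<in>carrier M. \<forall>y\<in>carrier M. f (x \<oplus>\<^bsub>M\<^esub> y) = f x \<oplus>\<^bsub>N\<^esub> f y) \<and>
     (\<forall>a\<in>carrier R. \<forall>x\<in>carrier M. f (a \<odot>\<^bsub>M\<^esub> x) = \<sigma> a \<odot>\<^bsub>N\<^esub> f x)}"


section \<open>Gluings\<close>

definition gluing :: "K octo \<Rightarrow> K octo set" where
  "gluing v = {g + oscale a (oscale (1 / sqrt5) v) | g a. g \<in> G0 \<and> a \<in> Zphi}"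

definition glue :: "K octo set set \<Rightarrow> K octo set" where
  "glue C = {oscale (1 / sqrt5) v | v. v \<in> G0 \<and> class_mod_pi v \<in> C}"

definition strict_norm_integral_overmodule :: "K octo set \<Rightarrow> bool" where
  "strict_norm_integral_overmodule M \<longleftrightarrow>
     submodule M Zphi_ring (oct_module UNIV) \<and> G0 \<subset> M \<and> (\<forall>x\<in>M. oct_norm x \<in> Zphi)"

end

(* The polar form on the icosians has unit determinant over Z[phi], so G0 is its own dual lattice:
   the coordinates of v in the basis of G0 are polar values B(v, d) with d in G0. If B(v / sqrt5, g)
   is integral for all g in G0, every coordinate of v is therefore divisible by sqrt5, that is,
   v lies in sqrt5 G0. If the norm were integral on G0 + C / sqrt5, then so would be its
   polarization B(v / sqrt5, g) for every v over C, which forces C = 0. *)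
theory Submission
  imports Defs
begin

section \<open>Arithmetic of \<open>\<int>[\<phi>]\<close>\<close>

lemma phi_squared: "\<phi> * \<phi> = \<phi> + 1"
  by transfer (simp add: field_simps)

lemma sqrt5_eq: "sqrt5 = 2 * \<phi> - 1"
proof -
  have "sqrt5 = \<phi> + \<phi> - 1" by transfer (simp add: field_simps)
  then show ?thesis by simp
qed

lemma sqrt5_neq_0: "sqrt5 \<noteq> 0"
  by transfer simp

lemma Rep_K_of_int: "Rep_K (of_int n) = of_int n"
  by (cases n rule: int_diff_cases) (simp add: Rep_K_of_nat minus_K.rep_eq)

text \<open>In the basis 1, \<open>sqrt 5\<close> the element is p + q \<open>sqrt 5\<close> with p
  = a + b/2 and q = b/2. Multiplying by the conjugate makes p^2 - 5 q^2 vanish, which irrationality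
  of \<open>sqrt 5\<close> allows only for p = q = 0.\<close>

lemma of_int_phi_eq_0:
  assumes "of_int a + of_int b * \<phi> = (0::K)"
  shows "a = 0 \<and> b = 0"
proof (rule ccontr)
  assume "\<not> (a = 0 \<and> b = 0)"
  moreover define p q where "p = of_int a + of_int b / (2::real)" and "q = of_int b / (2::real)"
  ultimately have "p\<^sup>2 - 5 * q\<^sup>2 \<noteq> 0"
    by (intro sqrt5_norm_neq_0) (simp_all add: p_def q_def, auto)
  moreover have "p + q * sqrt 5 = Rep_K (of_int a + of_int b * \<phi>)"
    by (simp add: p_def q_def plus_K.rep_eq times_K.rep_eq phi.rep_eq Rep_K_of_int field_simps)
  then have "p + q * sqrt 5 = 0"
    using assms by (simp add: zero_K.rep_eq)
  then have "(p + q * sqrt 5) * (p - q * sqrt 5) = 0" by simp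
  then have "p\<^sup>2 - 5 * q\<^sup>2 = 0" by (simp add: algebra_simps power2_eq_square)
  ultimately show False by simp
qed

lemma of_int_phi_inject:
  "of_int a + of_int b * \<phi> = of_int c + of_int d * \<phi> \<longleftrightarrow> a = c \<and> b = d"
proof
  assume "of_int a + of_int b * \<phi> = of_int c + of_int d * \<phi>"
  then have "of_int (a - c) + of_int (b - d) * \<phi> = 0" by (simp add: algebra_simps)
  then show "a = c \<and> b = d" using of_int_phi_eq_0 by fastforce
qed simp

section \<open>Closure of \<int>[\<phi>] under the ring operations\<close>

lemma Zphi_cases:
  assumes "x \<in> Zphi"
  obtains a b where "x = of_int a + of_int b * \<phi>"
  using assms by (auto simp: Zphi_def)

lemma Zphi_of_int_phi [intro]: "of_int a + of_int b * \<phi> \<in> Zphi"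
  by (auto simp: Zphi_def)

lemma Zphi_of_int [simp]: "of_int a \<in> Zphi"
  using Zphi_of_int_phi[of a 0] by simp

lemma Zphi_numeral [simp]: "0 \<in> Zphi" "1 \<in> Zphi" "numeral n \<in> Zphi"
  using Zphi_of_int[of 0] Zphi_of_int[of 1] Zphi_of_int[of "numeral n"] by simp_all

lemma Zphi_phi [simp]: "\<phi> \<in> Zphi"
  using Zphi_of_int_phi[of 0 1] by simp

lemma Zphi_add [simp]:
  assumes "x \<in> Zphi" "y \<in> Zphi"
  shows "x + y \<in> Zphi"
proof -
  obtain a b c d where "x = of_int a + of_int b * \<phi>" "y = of_int c + of_int d * \<phi>"
    using assms by (meson Zphi_cases)
  then have "x + y = of_int (a + c) + of_int (b + d) * \<phi>" by (simp add: algebra_simps)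
  then show ?thesis by (simp only: Zphi_of_int_phi)
qed

lemma of_int_phi_mult:
  "(of_int a + of_int b * \<phi>) * (of_int c + of_int d * \<phi>) =
    of_int (a * c + b * d) + of_int (a * d + b * c + b * d) * \<phi>"
proof -
  have "(of_int a + of_int b * \<phi>) * (of_int c + of_int d * \<phi>) =
    of_int (a * c) + of_int (a * d + b * c) * \<phi> + of_int (b * d) * (\<phi> * \<phi>)"
    by (simp add: algebra_simps)
  then show ?thesis by (simp add: phi_squared algebra_simps)
qed

lemma Zphi_mult [simp]:
  assumes "x \<in> Zphi" "y \<in> Zphi"
  shows "x * y \<in> Zphi"
  using assms by (elim Zphi_cases) (simp only: of_int_phi_mult Zphi_of_int_phi)

lemma Zphi_minus [simp]: "x \<in> Zphi \<Longrightarrow> - x \<in> Zphi"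
  using Zphi_mult[of "of_int (- 1)" x] Zphi_of_int[of "- 1"] by simp

lemma Zphi_diff [simp]: "x \<in> Zphi \<Longrightarrow> y \<in> Zphi \<Longrightarrow> x - y \<in> Zphi"
  using Zphi_add[of x "- y"] by simp

lemma Zphi_sqrt5 [simp]: "sqrt5 \<in> Zphi"
  by (simp add: sqrt5_eq)

lemma cring_Zphi_ring: "cring Zphi_ring"
proof (rule cringI)
  show "abelian_group Zphi_ring"
    by (rule abelian_groupI)
      (auto simp: Zphi_ring_def algebra_simps intro!: bexI[of _ "- x" for x])
  show "Group.comm_monoid Zphi_ring"
    by (rule comm_monoidI) (auto simp: Zphi_ring_def algebra_simps)
qed (auto simp: Zphi_ring_def algebra_simps)


section \<open>Reduction modulo \<open>\<surd>5\<close>\<close>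

text \<open>Modulo \<open>\<surd>5 = 2\<phi> - 1\<close> the golden ratio becomes \<open>1/2 = 3\<close>.\<close>

definition red5 :: "K \<Rightarrow> int" where
  "red5 x = (THE n. \<exists>a b. x = of_int a + of_int b * \<phi> \<and> n = (a + 3 * b) mod 5)"

text \<open>The integer coordinates a, b are unique, so the description in \<open>red5\<close> picks
  out exactly one value.\<close>

lemma red5_of_int_phi: "red5 (of_int a + of_int b * \<phi>) = (a + 3 * b) mod 5"
  unfolding red5_def by (rule the_equality) (auto simp: of_int_phi_inject)

lemma red5_of_int: "red5 (of_int a) = a mod 5"
  using red5_of_int_phi[of a 0] by simp

lemma red5_range: "x \<in> Zphi \<Longrightarrow> red5 x \<in> {0..4}"
  by (elim Zphi_cases) (auto simp: red5_of_int_phi intro: pos_mod_bound[of 5, simplified zle_diff1_eq])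

lemma red5_add:
  assumes "x \<in> Zphi" "y \<in> Zphi"
  shows "red5 (x + y) = (red5 x + red5 y) mod 5"
proof -
  obtain a b c d where xy: "x = of_int a + of_int b * \<phi>" "y = of_int c + of_int d * \<phi>"
    using assms by (meson Zphi_cases)
  then have "x + y = of_int (a + c) + of_int (b + d) * \<phi>" by (simp add: algebra_simps)
  then have "red5 (x + y) = ((a + 3 * b) + (c + 3 * d)) mod 5"
    by (simp only: red5_of_int_phi) (simp add: algebra_simps)
  then show ?thesis by (simp only: xy red5_of_int_phi mod_add_eq)
qed

lemma red5_mult:
  assumes "x \<in> Zphi" "y \<in> Zphi"
  shows "red5 (x * y) = (red5 x * red5 y) mod 5"
proof -
  obtain a b c d where xy: "x = of_int a + of_int b * \<phi>" "y = of_int c + of_int d * \<phi>"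
    using assms by (meson Zphi_cases)
  have "red5 (x * y) = (a * c + b * d + 3 * (a * d + b * c + b * d)) mod 5"
    by (simp only: xy of_int_phi_mult red5_of_int_phi)
  \<comment> \<open>3 is a root of X^2 - X - 1 modulo 5: the coefficient of b d is 4 on the left and
    9 in the product, and the multiple of 5 makes up the difference.\<close>
  also have "\<dots> = ((a + 3 * b) * (c + 3 * d) + (- b * d) * 5) mod 5"
    by (simp add: algebra_simps)
  also have "\<dots> = ((a + 3 * b) * (c + 3 * d)) mod 5"
    by (rule mod_mult_self1)
  finally show ?thesis by (simp only: xy red5_of_int_phi mod_mult_eq)
qed

lemma red5_eq_0_iff:
  assumes "x \<in> Zphi"
  shows "red5 x = 0 \<longleftrightarrow> (\<exists>y\<in>Zphi. x = sqrt5 * y)"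
proof
  obtain a b where x: "x = of_int a + of_int b * \<phi>"
    using assms by (rule Zphi_cases)
  assume "red5 x = 0"
  then obtain m where m: "a + 3 * b = 5 * m"
    by (auto simp: x red5_of_int_phi)
  \<comment> \<open>The quotient is x \<open>sqrt5\<close> / 5, with coordinates (2 b - a)/5 and (2
    a + b)/5; inserting a = 5 m - 3 b gives b - m and 2 m - b.\<close>
  have "sqrt5 * (of_int (b - m) + of_int (2 * m - b) * \<phi>) =
      (of_int (- 1) + of_int 2 * \<phi>) * (of_int (b - m) + of_int (2 * m - b) * \<phi>)"
    by (simp add: sqrt5_eq)
  also have "\<dots> = of_int (5 * m - 3 * b) + of_int b * \<phi>"
    unfolding of_int_phi_mult by (simp add: algebra_simps)
  also have "5 * m - 3 * b = a" using m by simp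
  finally show "\<exists>y\<in>Zphi. x = sqrt5 * y" using x by (metis Zphi_of_int_phi)
next
  have "red5 sqrt5 = 0" using red5_of_int_phi[of "- 1" 2] by (simp add: sqrt5_eq)
  then show "\<exists>y\<in>Zphi. x = sqrt5 * y \<Longrightarrow> red5 x = 0" by (auto simp: red5_mult)
qed

lemma red5_eq_iff:
  assumes "x \<in> Zphi" "y \<in> Zphi"
  shows "red5 x = red5 y \<longleftrightarrow> (\<exists>z\<in>Zphi. x - y = sqrt5 * z)"
proof -
  have "red5 x = (red5 (x - y) + red5 y) mod 5"
    using red5_add[of "x - y" y] assms by simp
  \<comment> \<open>\<open>red5\<close> is additive only up to \<open>mod 5\<close>; the range makes
    congruent values equal.\<close>
  moreover have "red5 (x - y) \<in> {0..4}" "red5 y \<in> {0..4}"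
    using assms by (simp_all only: red5_range Zphi_diff)
  ultimately have "red5 x = red5 y \<longleftrightarrow> red5 (x - y) = 0"
    unfolding atLeastAtMost_iff by presburger
  then show ?thesis using assms by (simp add: red5_eq_0_iff)
qed

section \<open>The residue field of \<int>[\<phi>] at \<open>sqrt5\<close>\<close>

interpretation residues5: residues 5 "residue_ring 5"
  by unfold_locales simp_all

lemma red5_ring_hom: "ring_hom_ring Zphi_ring (residue_ring 5) red5"
proof -
  have "red5 \<in> ring_hom Zphi_ring (residue_ring 5)"
    using red5_of_int[of 1] red5_range
    by (intro ring_hom_memI)
      (auto simp: Zphi_ring_def residue_ring_def red5_add red5_mult)
  then show ?thesis
    by (intro ring_hom_ringI2 cring.axioms(1) cring_Zphi_ring residues5.cring)
qed

lemma red5_surj: "red5 ` Zphi = {0..4}"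
proof
  show "{0..4} \<subseteq> red5 ` Zphi"
  proof
    fix n :: int assume "n \<in> {0..4}"
    then have "n = red5 (of_int n)" by (simp add: red5_of_int)
    then show "n \<in> red5 ` Zphi" using Zphi_of_int by (rule image_eqI)
  qed
qed (use red5_range in blast)

lemma red5_kernel: "a_kernel Zphi_ring (residue_ring 5) red5 = PIdl\<^bsub>Zphi_ring\<^esub> sqrt5"
proof -
  have "x \<in> Zphi \<and> red5 x = 0 \<longleftrightarrow> (\<exists>y\<in>Zphi. x = y * sqrt5)" for x
    using red5_eq_0_iff[of x] by (auto simp: mult.commute)
  then show ?thesis
    unfolding a_kernel_def' cgenideal_def
    by (auto simp: Zphi_ring_def residue_ring_def)
qed

text \<open>The map induced by \<open>red5\<close> on cosets of its kernel. On each coset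
  \<open>red5\<close> is constant, so the image is a singleton.\<close>

definition residue_iso :: "K set \<Rightarrow> int" where
  "residue_iso A = the_elem (red5 ` A)"

text \<open>First isomorphism theorem for \<open>red5\<close>, which is onto and has the principal
  ideal of \<open>sqrt5\<close> as kernel.\<close>

lemma residue_iso: "residue_iso \<in> ring_iso residue_field (residue_ring 5)"
proof -
  interpret ring_hom_ring Zphi_ring "residue_ring 5" red5 by (rule red5_ring_hom)
  have "(\<lambda>A. the_elem (red5 ` A)) \<in> ring_iso residue_field (residue_ring 5)"
    unfolding residue_field_def red5_kernel[symmetric]
    by (rule FactRing_iso_set) (simp add: Zphi_ring_def residue_ring_def red5_surj)
  then show ?thesis by (simp add: residue_iso_def[abs_def])
qed

text \<open>Cosets of the kernel are fibres of \<open>red5\<close>; in this form scalars of the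
  quotient module can be computed with.\<close>

lemma residue_field_coset:
  assumes "a \<in> Zphi"
  shows "PIdl\<^bsub>Zphi_ring\<^esub> sqrt5 +>\<^bsub>Zphi_ring\<^esub> a = {x \<in> Zphi. red5 x = red5 a}"
proof -
  have "x \<in> Zphi \<and> red5 x = red5 a \<longleftrightarrow> (\<exists>z\<in>Zphi. x = z * sqrt5 + a)" for x
  proof
    show "x \<in> Zphi \<and> red5 x = red5 a \<Longrightarrow> \<exists>z\<in>Zphi. x = z * sqrt5 + a"
      using assms by (auto simp: red5_eq_iff algebra_simps)
  next
    assume "\<exists>z\<in>Zphi. x = z * sqrt5 + a"
    then obtain z where "z \<in> Zphi" "x = z * sqrt5 + a" by blast
    then show "x \<in> Zphi \<and> red5 x = red5 a"
      using assms by (auto simp: red5_eq_iff)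
  qed
  then show ?thesis
    unfolding a_r_coset_def' cgenideal_def by (auto simp: Zphi_ring_def)
qed

lemma residue_field_carrier:
  "carrier residue_field = (\<lambda>a. {x \<in> Zphi. red5 x = red5 a}) ` Zphi"
proof -
  have "carrier residue_field = (\<lambda>a. PIdl\<^bsub>Zphi_ring\<^esub> sqrt5 +>\<^bsub>Zphi_ring\<^esub> a) ` Zphi"
    by (auto simp: residue_field_def FactRing_def A_RCOSETS_def' Zphi_ring_def)
  then show ?thesis by (simp add: residue_field_coset cong: image_cong_simp)
qed

lemma residue_iso_coset:
  assumes "a \<in> Zphi"
  shows "residue_iso {x \<in> Zphi. red5 x = red5 a} = red5 a"
proof -
  have "red5 ` {x \<in> Zphi. red5 x = red5 a} = {red5 a}" using assms by auto
  then show ?thesis by (simp add: residue_iso_def)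
qed


section \<open>The polar form and coordinates on \<open>G\<^sub>0\<close>\<close>

lemmas quat_defs = zero_quat_def one_quat_def plus_quat_def minus_quat_def uminus_quat_def
  times_quat_def qconj_def qscale_def

lemma oct_norm_eq:
  "oct_norm (Oct a b) = (qre a)\<^sup>2 + (qi a)\<^sup>2 + (qj a)\<^sup>2 + (qk a)\<^sup>2
    + (qre b)\<^sup>2 + (qi b)\<^sup>2 + (qj b)\<^sup>2 + (qk b)\<^sup>2"
  by (simp add: oct_norm_def oconj_def times_octo_def quat_defs power2_eq_square)

lemma polar_eq:
  "polar (Oct a b) (Oct c d) = 2 * (qre a * qre c + qi a * qi c + qj a * qj c + qk a * qk c
    + qre b * qre d + qi b * qi d + qj b * qj d + qk b * qk d)"
  by (simp add: polar_def oct_norm_eq plus_octo_def plus_quat_def power2_eq_square algebra_simps)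

lemma polar_add_left: "polar (x + y) z = polar x z + polar y z"
  by (cases x; cases y; cases z) (simp add: polar_eq plus_octo_def plus_quat_def algebra_simps)

lemma polar_scale_left: "polar (oscale c x) y = c * polar x y"
  by (cases x; cases y) (simp add: polar_eq oscale_def qscale_def algebra_simps)

text \<open>The Gram matrix of \<open>e\<^sub>1, \<dots>, e\<^sub>4\<close> under the polar form has determinant \<open>\<phi>\<^sup>2\<close>, a unit, so the
  basis dual to it consists of icosians.\<close>

definition dual_basis :: "nat \<Rightarrow> K octo" where
  "dual_basis i =
    (let d = [Quat (1/2) 0 ((1 - \<phi>)/2) ((\<phi> - 2)/2), Quat 0 (1/2) ((2 - \<phi>)/2) ((\<phi> - 3)/2),
        Quat 0 0 0 1, Quat 0 0 (1 - \<phi>) (\<phi> - 1)]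
     in if i < 4 then Oct (d ! i) 0 else Oct 0 (d ! (i - 4)))"

text \<open>Coordinates are taken as polar values, so that integrality of the polar form becomes
  integrality of coordinates.\<close>

definition ocoord :: "K octo \<Rightarrow> nat \<Rightarrow> K" where
  "ocoord x i = polar x (dual_basis i)"

definition ocomb :: "(nat \<Rightarrow> K) \<Rightarrow> K octo" where
  "ocomb y = Oct (qscale (y 0) e1 + qscale (y 1) e2 + qscale (y 2) e3 + qscale (y 3) e4)
    (qscale (y 4) e1 + qscale (y 5) e2 + qscale (y 6) e3 + qscale (y 7) e4)"

lemma less_8_cases: "i < 8 \<Longrightarrow> i \<in> {0, 1, 2, 3, 4, 5, 6, 7::nat}"
  by auto

text \<open>The form of \<open>phi_squared\<close> that applies inside a longer product nested to
  the right.\<close>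

lemma phi_cancel: "\<phi> * (\<phi> * x) = \<phi> * x + x"
  by (simp add: phi_squared distrib_right flip: mult.assoc)

text \<open>This is the duality B(e_i, d_j) = 1 for i = j and 0 otherwise, for the eight basis
  vectors e_i of \<open>G0\<close> and d_j = \<open>dual_basis j\<close>.\<close>

lemma ocoord_ocomb: "i < 8 \<Longrightarrow> ocoord (ocomb y) i = y i"
  by (drule less_8_cases)
    (auto simp: ocoord_def ocomb_def polar_eq dual_basis_def e1_def e2_def e3_def e4_def
      qscale_def plus_quat_def zero_quat_def field_simps phi_squared phi_cancel)

lemma ocomb_ocoord: "ocomb (ocoord x) = x"
  by (cases x; cases "oct1 x"; cases "oct2 x")
    (auto simp: ocoord_def ocomb_def polar_eq dual_basis_def e1_def e2_def e3_def e4_def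
      qscale_def plus_quat_def zero_quat_def field_simps phi_squared phi_cancel)

text \<open>\<open>ocomb\<close> reads only the indices below 8; beyond them
  \<open>dual_basis\<close> is unspecified. Identities between octonions can thus be checked by
  coordinates.\<close>

lemma ocoord_inject: "(\<And>i. i < 8 \<Longrightarrow> ocoord x i = ocoord y i) \<Longrightarrow> x = y"
  by (subst (1 2) ocomb_ocoord[symmetric]) (simp add: ocomb_def)

lemma ocoord_add: "ocoord (x + y) i = ocoord x i + ocoord y i"
  by (simp add: ocoord_def polar_add_left)

lemma ocoord_scale: "ocoord (oscale c x) i = c * ocoord x i"
  by (simp add: ocoord_def polar_scale_left)

lemma oscale_minus_one: "oscale (- 1) x = - x"
  by (simp add: oscale_def qscale_def uminus_octo_def uminus_quat_def)

lemma ocoord_diff: "ocoord (x - y) i = ocoord x i - ocoord y i"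
  using ocoord_add[of x "oscale (- 1) y" i] by (simp add: ocoord_scale) (simp add: oscale_minus_one)

lemma ocomb_in_G0: "(\<And>i. i < 8 \<Longrightarrow> y i \<in> Zphi) \<Longrightarrow> ocomb y \<in> G0"
  unfolding G0_def ocomb_def icosians_def by fastforce

text \<open>Coordinates over K are unique, so membership in the free module is their integrality.
  Closure properties of \<open>G0\<close> then follow from linearity of
  \<open>ocoord\<close>.\<close>

lemma G0_iff: "x \<in> G0 \<longleftrightarrow> (\<forall>i<8. ocoord x i \<in> Zphi)"
proof
  assume "x \<in> G0"
  then obtain A B where AB: "x = Oct A B" "A \<in> icosians" "B \<in> icosians"
    unfolding G0_def by blast
  obtain a b c d where "A = qscale a e1 + qscale b e2 + qscale c e3 + qscale d e4"
    "a \<in> Zphi" "b \<in> Zphi" "c \<in> Zphi" "d \<in> Zphi"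
    using AB(2) unfolding icosians_def mem_Collect_eq by (elim exE conjE)
  moreover obtain p q r s where "B = qscale p e1 + qscale q e2 + qscale r e3 + qscale s e4"
    "p \<in> Zphi" "q \<in> Zphi" "r \<in> Zphi" "s \<in> Zphi"
    using AB(3) unfolding icosians_def mem_Collect_eq by (elim exE conjE)
  moreover define y where "y = (!) [a, b, c, d, p, q, r, s]"
  ultimately have "x = ocomb y" and "\<forall>i<8. y i \<in> Zphi"
    by (auto simp: AB(1) ocomb_def dest!: less_8_cases)
  then show "\<forall>i<8. ocoord x i \<in> Zphi" by (simp add: ocoord_ocomb)
next
  assume "\<forall>i<8. ocoord x i \<in> Zphi"
  then show "x \<in> G0" using ocomb_in_G0[of "ocoord x"] by (simp add: ocomb_ocoord)
qed

text \<open>The coordinates of d_i are the values B(d_i, d_j), that is, the entries of the inverse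
  Gram matrix. Their integrality is the self-duality of \<open>G0\<close>.\<close>

lemma dual_basis_in_G0:
  assumes "i < 8"
  shows "dual_basis i \<in> G0"
proof -
  have "ocoord (dual_basis i) j \<in> Zphi" if "j < 8" for j
    using less_8_cases[OF assms] less_8_cases[OF that]
    by (auto simp: ocoord_def polar_eq dual_basis_def zero_quat_def field_simps phi_squared)
      (simp_all add: diff_divide_distrib)
  then show ?thesis by (simp add: G0_iff)
qed

section \<open>Linear structure of \<open>G0\<close> and divisibility by
  \<open>sqrt5\<close>\<close>

lemma G0_add: "x \<in> G0 \<Longrightarrow> y \<in> G0 \<Longrightarrow> x + y \<in> G0"
  by (simp add: G0_iff ocoord_add)

lemma G0_scale: "c \<in> Zphi \<Longrightarrow> x \<in> G0 \<Longrightarrow> oscale c x \<in> G0"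
  by (simp add: G0_iff ocoord_scale)

lemma oscale_oscale: "oscale a (oscale b x) = oscale (a * b) (x::K octo)"
  by (rule ocoord_inject) (simp add: ocoord_scale)

lemma oscale_add: "oscale a (x + y) = oscale a x + oscale a (y::K octo)"
  by (rule ocoord_inject) (simp add: ocoord_scale ocoord_add algebra_simps)

lemma oscale_one: "oscale 1 x = (x::K octo)"
  by (rule ocoord_inject) (simp add: ocoord_scale)

lemma piG0_iff: "x \<in> piG0 \<longleftrightarrow> (\<forall>i<8. \<exists>z\<in>Zphi. ocoord x i = sqrt5 * z)"
proof
  assume "\<forall>i<8. \<exists>z\<in>Zphi. ocoord x i = sqrt5 * z"
  then have "\<forall>i<8. ocoord (oscale (1 / sqrt5) x) i \<in> Zphi"
    using sqrt5_neq_0 by (auto simp: ocoord_scale)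
  then have "oscale (1 / sqrt5) x \<in> G0" by (simp add: G0_iff)
  moreover have "x = oscale sqrt5 (oscale (1 / sqrt5) x)"
    using sqrt5_neq_0 by (simp add: oscale_oscale oscale_one)
  ultimately show "x \<in> piG0" unfolding piG0_def by blast
qed (auto simp: piG0_def G0_iff ocoord_scale)

text \<open>Testing against g = \<open>dual_basis i\<close> shows that v / \<open>sqrt5\<close> has
  integral coordinates.\<close>

lemma no_polar_integral_line:
  assumes "v \<in> G0" "\<And>g. g \<in> G0 \<Longrightarrow> polar (oscale (1 / sqrt5) v) g \<in> Zphi"
  shows "v \<in> piG0"
  unfolding piG0_iff
proof (intro allI impI)
  fix i :: nat assume "i < 8"
  then have "ocoord (oscale (1 / sqrt5) v) i \<in> Zphi"
    using assms dual_basis_in_G0 by (simp add: ocoord_def)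
  moreover have "ocoord v i = sqrt5 * ocoord (oscale (1 / sqrt5) v) i"
    using sqrt5_neq_0 by (simp add: ocoord_scale)
  ultimately show "\<exists>z\<in>Zphi. ocoord v i = sqrt5 * z" by blast
qed


section \<open>The quotient \<open>G\<^sub>0/\<surd>5 G\<^sub>0\<close>\<close>

text \<open>Restricted to eight indices because \<open>coord_module\<close> has extensional
  functions as elements.\<close>

definition red_coord :: "K octo \<Rightarrow> nat \<Rightarrow> int" where
  "red_coord v = (\<lambda>i\<in>{..<8}. red5 (ocoord v i))"

lemma red_coord_eq_iff:
  assumes "u \<in> G0" "v \<in> G0"
  shows "red_coord u = red_coord v \<longleftrightarrow> u - v \<in> piG0"
proof -
  have "red_coord u = red_coord v \<longleftrightarrow> (\<forall>i<8. red5 (ocoord u i) = red5 (ocoord v i))"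
    unfolding red_coord_def by (metis (mono_tags, lifting) lessThan_iff restrict_apply' restrict_ext)
  then show ?thesis
    using assms by (simp add: G0_iff piG0_iff red5_eq_iff ocoord_diff)
qed

text \<open>Two elements of \<open>G0\<close> differ by an element of \<open>piG0\<close> exactly
  when their reduced coordinates agree. Classes thereby become fibres of
  \<open>red_coord\<close>.\<close>

lemma class_mod_pi_eq:
  assumes "v \<in> G0"
  shows "class_mod_pi v = {u \<in> G0. red_coord u = red_coord v}"
proof -
  have "class_mod_pi v = (\<lambda>h. h + v) ` piG0"
    by (auto simp: class_mod_pi_def a_r_coset_def' oct_module_def)
  also have "\<dots> = {u. u - v \<in> piG0}"
  proof (intro equalityI subsetI)
    fix u assume "u \<in> {u. u - v \<in> piG0}"
    then show "u \<in> (\<lambda>h. h + v) ` piG0" by (intro image_eqI[of _ _ "u - v"]) auto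
  qed auto
  also have "\<dots> = {u \<in> G0. red_coord u = red_coord v}"
  proof -
    have "u \<in> G0" if "u - v \<in> piG0" for u
    proof -
      have "u - v \<in> G0" using that by (auto simp: piG0_def G0_scale)
      then show ?thesis using G0_add[OF _ assms, of "u - v"] by simp
    qed
    then show ?thesis using assms by (auto simp: red_coord_eq_iff)
  qed
  finally show ?thesis .
qed

lemma class_mod_pi_refl: "v \<in> G0 \<Longrightarrow> v \<in> class_mod_pi v"
  by (simp add: class_mod_pi_eq)

lemma class_mod_pi_eq_iff:
  assumes "v \<in> G0" "w \<in> G0"
  shows "class_mod_pi v = class_mod_pi w \<longleftrightarrow> red_coord v = red_coord w"
  using assms by (auto simp: class_mod_pi_eq)

section \<open>Addition and scalar multiplication in the quotient\<close>

lemma red_coord_add: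
  assumes "u \<in> G0" "v \<in> G0"
  shows "red_coord (u + v) = (\<lambda>i\<in>{..<8}. (red_coord u i + red_coord v i) mod 5)"
  using assms by (auto simp: red_coord_def ocoord_add red5_add G0_iff)

lemma red_coord_scale:
  assumes "a \<in> Zphi" "v \<in> G0"
  shows "red_coord (oscale a v) = (\<lambda>i\<in>{..<8}. (red5 a * red_coord v i) mod 5)"
  using assms by (auto simp: red_coord_def ocoord_scale red5_mult G0_iff)

lemma carrier_G0_mod_pi: "carrier G0_mod_pi = class_mod_pi ` G0"
  by (auto simp: G0_mod_pi_def quot_module_def A_RCOSETS_def' class_mod_pi_def)
    (auto simp: oct_module_def)

lemma zero_G0_mod_pi: "\<zero>\<^bsub>G0_mod_pi\<^esub> = piG0"
  by (simp add: G0_mod_pi_def quot_module_def)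

lemma piG0_subset_G0: "piG0 \<subseteq> G0"
  by (auto simp: piG0_def G0_scale)

lemma zero_in_piG0: "0 \<in> piG0"
  using ocoord_diff[of 0 0] by (auto simp: piG0_iff)

lemma class_mod_pi_piG0:
  assumes "v \<in> piG0"
  shows "class_mod_pi v = piG0"
proof -
  have G0: "0 \<in> G0" "v \<in> G0" using assms zero_in_piG0 piG0_subset_G0 by auto
  then have "red_coord v = red_coord 0" using assms by (simp add: red_coord_eq_iff)
  then have "class_mod_pi v = class_mod_pi 0" using G0 by (simp add: class_mod_pi_eq_iff)
  also have "\<dots> = piG0"
    using G0 piG0_subset_G0 by (auto simp: class_mod_pi_eq red_coord_eq_iff)
  finally show ?thesis .
qed

lemma add_G0_mod_pi:
  assumes "v \<in> G0" "w \<in> G0"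
  shows "class_mod_pi v \<oplus>\<^bsub>G0_mod_pi\<^esub> class_mod_pi w = class_mod_pi (v + w)"
proof -
  have "class_mod_pi v \<oplus>\<^bsub>G0_mod_pi\<^esub> class_mod_pi w
      = (\<Union>x\<in>class_mod_pi v. \<Union>y\<in>class_mod_pi w. {x + y})"
    by (auto simp: G0_mod_pi_def quot_module_def set_add_def' oct_module_def)
  also have "\<dots> = class_mod_pi (v + w)"
  proof (intro equalityI subsetI)
    fix u assume "u \<in> class_mod_pi (v + w)"
    then have u: "u \<in> G0" "u - (v + w) \<in> piG0"
      using assms by (auto simp: class_mod_pi_eq G0_add red_coord_eq_iff)
    \<comment> \<open>The decomposition u = (u - w) + w keeps w as representative of its class and
      puts the whole correction into the other summand.\<close>
    then have "u - w \<in> G0"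
      using assms by (simp add: G0_iff ocoord_diff)
    moreover from this have "u - w \<in> class_mod_pi v"
      using u assms by (simp add: class_mod_pi_eq red_coord_eq_iff algebra_simps)
    ultimately show "u \<in> (\<Union>x\<in>class_mod_pi v. \<Union>y\<in>class_mod_pi w. {x + y})"
      using class_mod_pi_refl[OF assms(2)] by force
  qed (use assms in \<open>auto simp: class_mod_pi_eq G0_add red_coord_add\<close>)
  finally show ?thesis .
qed

text \<open>The double union in \<open>quot_module\<close> runs over all representatives. The class
  of each product depends only on \<open>red5 a\<close> and \<open>red_coord v\<close>, so all its
  members coincide.\<close>

lemma smult_G0_mod_pi:
  assumes "a \<in> Zphi" "v \<in> G0"
  shows "{x \<in> Zphi. red5 x = red5 a} \<odot>\<^bsub>G0_mod_pi\<^esub> class_mod_pi v = class_mod_pi (oscale a v)"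
proof -
  have "{x \<in> Zphi. red5 x = red5 a} \<odot>\<^bsub>G0_mod_pi\<^esub> class_mod_pi v
      = (\<Union>x\<in>{x \<in> Zphi. red5 x = red5 a}. \<Union>u\<in>class_mod_pi v. class_mod_pi (oscale x u))"
    by (simp add: G0_mod_pi_def quot_module_def class_mod_pi_def) (simp add: oct_module_def)
  also have "\<dots> = (\<Union>x\<in>{x \<in> Zphi. red5 x = red5 a}. \<Union>u\<in>class_mod_pi v. class_mod_pi (oscale a v))"
    using assms
    by (intro SUP_cong refl)
      (auto simp: class_mod_pi_eq_iff red_coord_scale G0_scale class_mod_pi_eq[of v])
  also have "\<dots> = class_mod_pi (oscale a v)"
    using assms class_mod_pi_refl by auto
  finally show ?thesis .
qed

lemma the_elem_red_coord:
  assumes "v \<in> G0"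
  shows "the_elem (red_coord ` class_mod_pi v) = red_coord v"
proof -
  have "red_coord ` class_mod_pi v = {red_coord v}"
    using assms by (auto simp: class_mod_pi_eq)
  then show ?thesis by simp
qed

lemma red_coord_image: "red_coord ` G0 = {..<8} \<rightarrow>\<^sub>E {0..4}"
proof (intro equalityI subsetI)
  fix y assume "y \<in> red_coord ` G0"
  then show "y \<in> {..<8} \<rightarrow>\<^sub>E {0..4}"
    using red5_range by (auto simp: red_coord_def G0_iff PiE_iff)
next
  fix y :: "nat \<Rightarrow> int" assume y: "y \<in> {..<8} \<rightarrow>\<^sub>E {0..4}"
  \<comment> \<open>Each residue is lifted to the integer representing it.\<close>
  define v where "v = ocomb (\<lambda>i. of_int (y i))"
  have "y i mod 5 = y i" if "i < 8" for i
  proof -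
    have "y i \<in> {0..4}" using y that by blast
    then show ?thesis by simp
  qed
  then have "red_coord v = y"
    using y by (auto simp: red_coord_def v_def ocoord_ocomb red5_of_int fun_eq_iff PiE_def extensional_def)
  moreover have "v \<in> G0" unfolding v_def by (rule ocomb_in_G0) simp
  ultimately show "y \<in> red_coord ` G0" by blast
qed

text \<open>Reduced coordinates identify the quotient with the eighth power of the field of 5
  elements; \<open>residue_iso\<close> transports the scalars.\<close>

lemma G0_mod_pi_semilinear_iso:
  "(\<lambda>X. the_elem (red_coord ` X)) \<in>
    semilinear_iso residue_iso residue_field G0_mod_pi (coord_module (residue_ring 5) 8)"
proof -
  let ?f = "\<lambda>X. the_elem (red_coord ` X)" and ?N = "coord_module (residue_ring 5) 8"
  have "inj_on ?f (class_mod_pi ` G0)"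
    by (auto simp: inj_on_def the_elem_red_coord class_mod_pi_eq_iff)
  moreover have "?f ` class_mod_pi ` G0 = carrier ?N"
    by (simp add: image_image the_elem_red_coord red_coord_image coord_module_def residue_ring_def
        cong: image_cong_simp)
  ultimately have "bij_betw ?f (carrier G0_mod_pi) (carrier ?N)"
    by (simp add: bij_betw_def carrier_G0_mod_pi)
  moreover have "?f (X \<oplus>\<^bsub>G0_mod_pi\<^esub> Y) = ?f X \<oplus>\<^bsub>?N\<^esub> ?f Y"
    if "X \<in> carrier G0_mod_pi" "Y \<in> carrier G0_mod_pi" for X Y
    using that
    by (auto simp: carrier_G0_mod_pi add_G0_mod_pi the_elem_red_coord G0_add red_coord_add
        coord_module_def residue_ring_def)
  moreover have "?f (A \<odot>\<^bsub>G0_mod_pi\<^esub> X) = residue_iso A \<odot>\<^bsub>?N\<^esub> ?f X"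
    if "A \<in> carrier residue_field" "X \<in> carrier G0_mod_pi" for A X
    using that
    by (auto simp: carrier_G0_mod_pi residue_field_carrier smult_G0_mod_pi the_elem_red_coord
        G0_scale red_coord_scale residue_iso_coset coord_module_def residue_ring_def)
  ultimately show ?thesis unfolding semilinear_iso_def by blast
qed

section \<open>Gluings\<close>

lemma proj_line_eq:
  assumes "v \<in> G0"
  shows "proj_line v = (\<lambda>a. class_mod_pi (oscale a v)) ` Zphi"
proof -
  have "proj_line v = (\<lambda>A. A \<odot>\<^bsub>G0_mod_pi\<^esub> class_mod_pi v) ` carrier residue_field"
    by (auto simp: proj_line_def)
  then show ?thesis
    using assms by (simp add: residue_field_carrier image_image smult_G0_mod_pi cong: image_cong_simp)
qed

text \<open>The class of w is a multiple of that of v, so w = a v + \<open>sqrt5\<close> g with g in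
  \<open>G0\<close>, and w / \<open>sqrt5\<close> = a v / \<open>sqrt5\<close> + g lies in the
  gluing of v. Equality of gluings follows by symmetry.\<close>

lemma gluing_mono:
  assumes "v \<in> G0" "w \<in> G0" "proj_line w \<subseteq> proj_line v"
  shows "gluing w \<subseteq> gluing v"
proof
  have "class_mod_pi w \<in> proj_line w"
    using assms by (auto simp: proj_line_eq oscale_one intro!: image_eqI[of _ _ 1])
  then obtain a where a: "a \<in> Zphi" "class_mod_pi w = class_mod_pi (oscale a v)"
    using assms by (auto simp: proj_line_eq)
  then have "w - oscale a v \<in> piG0"
    using assms by (simp add: class_mod_pi_eq_iff red_coord_eq_iff G0_scale)
  then obtain g where g: "g \<in> G0" "w = oscale sqrt5 g + oscale a v"
    unfolding piG0_def by (auto simp: algebra_simps)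
  fix x assume "x \<in> gluing w"
  then obtain h c where h: "h \<in> G0" "c \<in> Zphi" "x = h + oscale c (oscale (1 / sqrt5) w)"
    by (auto simp: gluing_def)
  have "x = (h + oscale c g) + oscale (c * a) (oscale (1 / sqrt5) v)"
    using sqrt5_neq_0 unfolding h(3) g(2)
    by (simp add: oscale_add oscale_oscale add.assoc mult.commute)
  moreover have "h + oscale c g \<in> G0" "c * a \<in> Zphi"
    using h g a by (simp_all add: G0_add G0_scale)
  ultimately show "x \<in> gluing v" unfolding gluing_def by blast
qed

text \<open>The obstruction lies in the norms alone, so it settles both negations about C in the
  theorem.\<close>

lemma glue_not_norm_integral:
  assumes C: "submodule C residue_field G0_mod_pi" "C \<noteq> {\<zero>\<^bsub>G0_mod_pi\<^esub>}"
  shows "\<exists>x\<in>glue C. oct_norm x \<notin> Zphi"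
proof (rule ccontr)
  assume "\<not> ?thesis"
  then have int: "oct_norm x \<in> Zphi" if "x \<in> glue C" for x using that by blast
  interpret submodule C residue_field G0_mod_pi by (rule C)
  \<comment> \<open>\<open>one_closed\<close> refers to the additive group: its neutral element is
    the zero class \<open>piG0\<close>.\<close>
  have "piG0 \<in> C" "C \<subseteq> class_mod_pi ` G0"
    using one_closed subset by (simp_all add: zero_G0_mod_pi carrier_G0_mod_pi)
  moreover obtain X where "X \<in> C" "X \<noteq> piG0"
    using C(2) \<open>piG0 \<in> C\<close> unfolding zero_G0_mod_pi by blast
  ultimately obtain v where v: "v \<in> G0" "class_mod_pi v \<in> C" "class_mod_pi v \<noteq> piG0"
    by blast
  let ?v = "oscale (1 / sqrt5) v"
  have "polar ?v g \<in> Zphi" if g: "g \<in> G0" for g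
  proof -
    have pig: "oscale sqrt5 g \<in> piG0" using g by (auto simp: piG0_def)
    have scale: "oscale (1 / sqrt5) (oscale sqrt5 g) = g"
      using sqrt5_neq_0 by (simp add: oscale_oscale oscale_one)
    have "?v \<in> glue C" using v by (auto simp: glue_def)
    \<comment> \<open>Written as (\<open>sqrt5\<close> g) / \<open>sqrt5\<close>, the element g lies
      over the zero class, which belongs to C.\<close>
    moreover have "g \<in> glue C"
      unfolding glue_def mem_Collect_eq
      using \<open>piG0 \<in> C\<close> class_mod_pi_piG0[OF pig] scale g
      by (intro exI[of _ "oscale sqrt5 g"]) (simp add: G0_scale)
    moreover have "?v + g \<in> glue C"
    proof -
      \<comment> \<open>Adding \<open>sqrt5\<close> g to v leaves its class unchanged, so the sum
        still lies over C.\<close>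
      have "class_mod_pi (v + oscale sqrt5 g) = class_mod_pi v"
        using v g pig by (simp add: class_mod_pi_eq_iff red_coord_eq_iff G0_add G0_scale)
      moreover have "?v + g = oscale (1 / sqrt5) (v + oscale sqrt5 g)"
        by (simp add: oscale_add scale)
      ultimately show ?thesis
        unfolding glue_def using v g by (auto simp: G0_add G0_scale)
    qed
    ultimately show ?thesis by (simp add: polar_def int)
  qed
  then have "v \<in> piG0" using v no_polar_integral_line by blast
  then show False using v class_mod_pi_piG0 by blast
qed

theorem proposition6p13:
  shows "sqrt5 = 2 * \<phi> - 1
    \<and> (\<exists>\<sigma>\<in>ring_iso residue_field (residue_ring 5).
          semilinear_iso \<sigma> residue_field G0_mod_pi (coord_module (residue_ring 5) 8) \<noteq> {})
    \<and> (\<forall>v\<in>G0 - piG0. \<forall>w\<in>G0 - piG0. proj_line v = proj_line w \<longrightarrow> gluing v = gluing w)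
    \<and> \<not> (\<exists>v\<in>G0 - piG0. \<forall>g\<in>G0. polar (oscale (1 / sqrt5) v) g \<in> Zphi)
    \<and> (\<forall>C. submodule C residue_field G0_mod_pi \<and> C \<noteq> {\<zero>\<^bsub>G0_mod_pi\<^esub>} \<longrightarrow>
          \<not> strict_norm_integral_overmodule (glue C) \<and> \<not> (\<forall>x\<in>glue C. oct_norm x \<in> Zphi))"
proof (intro conjI)
  show "sqrt5 = 2 * \<phi> - 1" by (rule sqrt5_eq)
  show "\<exists>\<sigma>\<in>ring_iso residue_field (residue_ring 5).
      semilinear_iso \<sigma> residue_field G0_mod_pi (coord_module (residue_ring 5) 8) \<noteq> {}"
    using residue_iso G0_mod_pi_semilinear_iso by blast
  show "\<forall>v\<in>G0 - piG0. \<forall>w\<in>G0 - piG0. proj_line v = proj_line w \<longrightarrow> gluing v = gluing w"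
    using gluing_mono by (metis DiffD1 order_refl subset_antisym)
  show "\<not> (\<exists>v\<in>G0 - piG0. \<forall>g\<in>G0. polar (oscale (1 / sqrt5) v) g \<in> Zphi)"
    using no_polar_integral_line by blast
  show "\<forall>C. submodule C residue_field G0_mod_pi \<and> C \<noteq> {\<zero>\<^bsub>G0_mod_pi\<^esub>} \<longrightarrow>
      \<not> strict_norm_integral_overmodule (glue C) \<and> \<not> (\<forall>x\<in>glue C. oct_norm x \<in> Zphi)"
    using glue_not_norm_integral unfolding strict_norm_integral_overmodule_def by blast
qed

end
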